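(* Consider the two-dimensional semi-discrete well-balanced central-upwind scheme defined in the context, $$\frac{d}{dt}\,\overline{\boldsymbol q}_{j,k}=-\frac{\boldsymbol{\mathcal F}_{j+\frac12,k}-\boldsymbol{\mathcal F}_{j-\frac12,k}}{\Delta x}-\frac{\boldsymbol{\mathcal G}_{j,k+\frac12}-\boldsymbol{\mathcal G}_{j,k-\frac12}}{\Delta y},\qquad j=j_\ell,\ldots,j_r,\ k=k_\ell,\ldots,k_r,$$ with the well-balanced reconstruction and the numerical fluxes given there. This scheme is well-balanced in the sense that it exactly preserves the steady state $u\equiv0$, $v\equiv0$, $K_x\equiv0$, $L_y\equiv0$. That is, if at some time the discrete data satisfy $u_{j,k}=v_{j,k}=0$ for all $j,k$, $K_{j,k}=\widehat K_k$ for all $j$, and $L_{j,k}=\widehat L_j$ for all $k$ (including the ghost cells), where $\widehat K_k$ depends only on $k$ and $\widehat L_j$ depends only on $j$, then the right-hand side $-\frac{1}{\Delta x}\big(\boldsymbol{\mathcal F}_{j+\frac12,k}-\boldsymbol{\mathcal F}_{j-\frac12,k}\big)-\frac{1}{\Delta y}\big(\boldsymbol{\mathcal G}_{j,k+\frac12}-\boldsymbol{\mathcal G}_{j,k-\frac12}\big)$ of the ODE system for $\overline{\boldsymbol q}_{j,k}$ is zero for all $j=j_\ell,\ldots,j_r$, $k=k_\ell,\ldots,k_r$.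
   Context: **Continuous system.** The 2-D Euler equations with gravitation in conservative form are $\boldsymbol q_t+\boldsymbol F(\boldsymbol q)_x+\boldsymbol G(\boldsymbol q)_y=\boldsymbol 0$ with $\boldsymbol q=(\rho,\rho u,\rho v,E+\rho\phi)^\top$, $$\boldsymbol F(\boldsymbol q)=(\rho u,\ \rho u^2+K,\ \rho uv,\ u(E+\rho\phi+p))^\top,\quad \boldsymbol G(\boldsymbol q)=(\rho v,\ \rho uv,\ \rho v^2+L,\ v(E+\rho\phi+p))^\top,$$ $p=(\gamma-1)(E-\frac12\rho(u^2+v^2))$, $\gamma>1$. Here $\phi=\phi(x,y)$ is a given time-independent continuous potential with partial derivatives $\phi_x,\phi_y$, and $K=p+Q$, $L=p+R$, $Q=\int^x\rho\,\phi_x\,d\xi$, $R=\int^y\rho\,\phi_y\,d\eta$. **Grid and data.** Uniform cells $C_{j,k}=[x_{j-\frac12},x_{j+\frac12}]\times[y_{k-\frac12},y_{k+\frac12}]$ with sizes $\Delta x,\Delta y>0$ and centers $(x_j,y_k)$, $j=j_\ell,\ldots,j_r$, $k=k_\ell,\ldots,k_r$. The unknowns are the cell averages $\overline{\boldsymbol q}_{j,k}=(\overline\rho,\overline{\rho u},\overline{\rho v},\overline{E+\rho\phi})_{j,k}^\top$. Set $\overline E_{j,k}=\overline{(E+\rho\phi)}_{j,k}-\overline\rho_{j,k}\phi(x_j,y_k)$, $u_{j,k}=\overline{(\rho u)}_{j,k}/\overline\rho_{j,k}$, $v_{j,k}=\overline{(\rho v)}_{j,k}/\overline\rho_{j,k}$,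 $p_{j,k}=(\gamma-1)(\overline E_{j,k}-\frac12\overline\rho_{j,k}(u_{j,k}^2+v_{j,k}^2))$. Define, for all $j=j_\ell,\ldots,j_r$ and $k=k_\ell,\ldots,k_r$, $$Q_{j_\ell-\frac12,k}=0,\quad Q_{j+\frac12,k}=Q_{j-\frac12,k}+\Delta x\,\overline\rho_{j,k}\phi_x(x_j,y_k),\quad Q_{j,k}=\tfrac12(Q_{j-\frac12,k}+Q_{j+\frac12,k}),$$ $$R_{j,k_\ell-\frac12}=0,\quad R_{j,k+\frac12}=R_{j,k-\frac12}+\Delta y\,\overline\rho_{j,k}\phi_y(x_j,y_k),\quad R_{j,k}=\tfrac12(R_{j,k-\frac12}+R_{j,k+\frac12}),$$ $$K_{j,k}=p_{j,k}+Q_{j,k},\qquad L_{j,k}=p_{j,k}+R_{j,k}.$$ Boundary conditions are imposed through ghost cells (two layers on each side), in which values of $\overline\rho,u,v$ are prescribed, together with $K$ for ghost cells to the left/right and $L$ for ghost cells below/above; there $\overline{\rho u}=\overline\rho u$, $\overline{\rho v}=\overline\rho v$. **Minmod function.** $\mathrm{minmod}(z_1,z_2,\ldots)$ equals $\min_i z_i$ if all $z_i>0$, $\max_i z_i$ if all $z_i<0$, and $0$ otherwise. For a grid function $w_{j,k}$ the generalized minmod slopes are, with $\theta\in[1,2]$, $$(w_x)_{j,k}=\mathrm{minmod}\Big(\theta\tfrac{w_{j+1,k}-w_{j,k}}{\Delta x},\tfrac{w_{j+1,k}-w_{j-1,k}}{2\Delta x},\theta\tfrac{w_{j,k}-w_{j-1,k}}{\Delta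 x}\Big),$$ and analogously $(w_y)_{j,k}$ in the $y$-direction. **Well-balanced reconstruction.** For $w\in\{\rho,\rho u,\rho v\}$ (using cell averages), $w^{\rm E}_{j,k}=w_{j,k}+\frac{\Delta x}2(w_x)_{j,k}$, $w^{\rm W}_{j,k}=w_{j,k}-\frac{\Delta x}2(w_x)_{j,k}$, $w^{\rm N}_{j,k}=w_{j,k}+\frac{\Delta y}2(w_y)_{j,k}$, $w^{\rm S}_{j,k}=w_{j,k}-\frac{\Delta y}2(w_y)_{j,k}$. Likewise $K^{\rm E,W}_{j,k}=K_{j,k}\pm\frac{\Delta x}2(K_x)_{j,k}$ and $L^{\rm N,S}_{j,k}=L_{j,k}\pm\frac{\Delta y}2(L_y)_{j,k}$. For each superscript ${\rm X}\in\{{\rm E,W,N,S}\}$: $u^{\rm X}=(\rho u)^{\rm X}/\rho^{\rm X}$, $v^{\rm X}=(\rho v)^{\rm X}/\rho^{\rm X}$. The pressures are $$p^{\rm E}_{j,k}=K^{\rm E}_{j,k}-Q_{j+\frac12,k},\quad p^{\rm W}_{j,k}=K^{\rm W}_{j,k}-Q_{j-\frac12,k},\quad p^{\rm N}_{j,k}=L^{\rm N}_{j,k}-R_{j,k+\frac12},\quad p^{\rm S}_{j,k}=L^{\rm S}_{j,k}-R_{j,k-\frac12},$$ and $E^{\rm X}=\frac{p^{\rm X}}{\gamma-1}+\frac12\rho^{\rm X}((u^{\rm X})^2+(v^{\rm X})^2)$, $c^{\rm X}=\sqrt{\gamma p^{\rm X}/\rho^{\rm X}}$. Also $(\rho\phi)^{\rm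 E}_{j,k}=\rho^{\rm E}_{j,k}\phi(x_{j+\frac12},y_k)$, $(\rho\phi)^{\rm W}_{j,k}=\rho^{\rm W}_{j,k}\phi(x_{j-\frac12},y_k)$, $(\rho\phi)^{\rm N}_{j,k}=\rho^{\rm N}_{j,k}\phi(x_j,y_{k+\frac12})$, $(\rho\phi)^{\rm S}_{j,k}=\rho^{\rm S}_{j,k}\phi(x_j,y_{k-\frac12})$, and $\boldsymbol q^{\rm X}=(\rho^{\rm X},(\rho u)^{\rm X},(\rho v)^{\rm X},E^{\rm X}+(\rho\phi)^{\rm X})^\top$; $\boldsymbol F(\boldsymbol q^{\rm E,W})$ and $\boldsymbol G(\boldsymbol q^{\rm N,S})$ are evaluated with the one-sided values (including $K^{\rm E,W}$, $L^{\rm N,S}$, $p^{\rm X}$). **Local speeds.** $a^+_{j+\frac12,k}=\max(u^{\rm E}_{j,k}+c^{\rm E}_{j,k},u^{\rm W}_{j+1,k}+c^{\rm W}_{j+1,k},0)$, $a^-_{j+\frac12,k}=\min(u^{\rm E}_{j,k}-c^{\rm E}_{j,k},u^{\rm W}_{j+1,k}-c^{\rm W}_{j+1,k},0)$, $b^+_{j,k+\frac12}=\max(v^{\rm N}_{j,k}+c^{\rm N}_{j,k},v^{\rm S}_{j,k+1}+c^{\rm S}_{j,k+1},0)$, $b^-_{j,k+\frac12}=\min(v^{\rm N}_{j,k}-c^{\rm N}_{j,k},v^{\rm S}_{j,k+1}-c^{\rm S}_{j,k+1},0)$, and $\alpha=\frac{a^+a^-}{a^+-a^-}$ at $(j+\frac12,k)$,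 $\beta=\frac{b^+b^-}{b^+-b^-}$ at $(j,k+\frac12)$. **Anti-diffusion** (componentwise minmod): $\delta\boldsymbol q_{j+\frac12,k}=\mathrm{minmod}(\boldsymbol q^{\rm W}_{j+1,k}-\boldsymbol q^*_{j+\frac12,k},\boldsymbol q^*_{j+\frac12,k}-\boldsymbol q^{\rm E}_{j,k})$, $\delta\boldsymbol q_{j,k+\frac12}=\mathrm{minmod}(\boldsymbol q^{\rm S}_{j,k+1}-\boldsymbol q^*_{j,k+\frac12},\boldsymbol q^*_{j,k+\frac12}-\boldsymbol q^{\rm N}_{j,k})$, where $$\boldsymbol q^*_{j+\frac12,k}=\frac{a^+\boldsymbol q^{\rm W}_{j+1,k}-a^-\boldsymbol q^{\rm E}_{j,k}-\{\boldsymbol F(\boldsymbol q^{\rm W}_{j+1,k})-\boldsymbol F(\boldsymbol q^{\rm E}_{j,k})\}}{a^+-a^-},\quad \boldsymbol q^*_{j,k+\frac12}=\frac{b^+\boldsymbol q^{\rm S}_{j,k+1}-b^-\boldsymbol q^{\rm N}_{j,k}-\{\boldsymbol G(\boldsymbol q^{\rm S}_{j,k+1})-\boldsymbol G(\boldsymbol q^{\rm N}_{j,k})\}}{b^+-b^-}$$ with $a^\pm=a^\pm_{j+\frac12,k}$, $b^\pm=b^\pm_{j,k+\frac12}$. **Cut-off.** $H(\psi)=\dfrac{(C\psi)^m}{1+(C\psi)^m}$ with fixed $C>0$ and positive integer $m$ (e.g. $C=200$, $m=6$), and $$\psi_{j+\frac12,k}=\frac{|K_{j+1,k}-K_{j,k}|}{\Delta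 x}\cdot\frac{x_{j_r+\frac12}-x_{j_\ell-\frac12}}{\max_{j,k}\{K_{j,k},K_{j+1,k}\}},\qquad \psi_{j,k+\frac12}=\frac{|L_{j,k+1}-L_{j,k}|}{\Delta y}\cdot\frac{y_{k_r+\frac12}-y_{k_\ell-\frac12}}{\max_{j,k}\{L_{j,k},L_{j,k+1}\}},$$ where the maxima are over all pairs of neighboring cells sharing an interface at which the flux is computed. **Numerical fluxes.** With all of $a^\pm,\alpha,\delta,\psi$ at $(j+\frac12,k)$, superscript E meaning the value in cell $(j,k)$ and W the value in cell $(j+1,k)$, the components of $\boldsymbol{\mathcal F}_{j+\frac12,k}$ are $$\mathcal F^{(1)}=\frac{a^+(\rho u)^{\rm E}-a^-(\rho u)^{\rm W}}{a^+-a^-}+\alpha H(\psi)(\rho^{\rm W}-\rho^{\rm E}-\delta\rho),$$ $$\mathcal F^{(2)}=\frac{a^+(\rho^{\rm E}(u^{\rm E})^2+K^{\rm E})-a^-(\rho^{\rm W}(u^{\rm W})^2+K^{\rm W})}{a^+-a^-}+\alpha((\rho u)^{\rm W}-(\rho u)^{\rm E}-\delta(\rho u)),$$ $$\mathcal F^{(3)}=\frac{a^+\rho^{\rm E}u^{\rm E}v^{\rm E}-a^-\rho^{\rm W}u^{\rm W}v^{\rm W}}{a^+-a^-}+\alpha((\rho v)^{\rm W}-(\rho v)^{\rm E}-\delta(\rho v)),$$ $$\mathcal F^{(4)}=\frac{a^+u^{\rm E}(E^{\rm E}+(\rho\phi)^{\rm E}+p^{\rm E})-a^-u^{\rm W}(E^{\rm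 W}+(\rho\phi)^{\rm W}+p^{\rm W})}{a^+-a^-}+\alpha\Big[E^{\rm W}-E^{\rm E}+H(\psi)\big((\rho\phi)^{\rm W}-(\rho\phi)^{\rm E}-\delta(E+\rho\phi)\big)\Big].$$ With all of $b^\pm,\beta,\delta,\psi$ at $(j,k+\frac12)$, superscript N meaning the value in cell $(j,k)$ and S the value in cell $(j,k+1)$, the components of $\boldsymbol{\mathcal G}_{j,k+\frac12}$ are $$\mathcal G^{(1)}=\frac{b^+(\rho v)^{\rm N}-b^-(\rho v)^{\rm S}}{b^+-b^-}+\beta H(\psi)(\rho^{\rm S}-\rho^{\rm N}-\delta\rho),$$ $$\mathcal G^{(2)}=\frac{b^+\rho^{\rm N}u^{\rm N}v^{\rm N}-b^-\rho^{\rm S}u^{\rm S}v^{\rm S}}{b^+-b^-}+\beta((\rho u)^{\rm S}-(\rho u)^{\rm N}-\delta(\rho u)),$$ $$\mathcal G^{(3)}=\frac{b^+(\rho^{\rm N}(v^{\rm N})^2+L^{\rm N})-b^-(\rho^{\rm S}(v^{\rm S})^2+L^{\rm S})}{b^+-b^-}+\beta((\rho v)^{\rm S}-(\rho v)^{\rm N}-\delta(\rho v)),$$ $$\mathcal G^{(4)}=\frac{b^+v^{\rm N}(E^{\rm N}+(\rho\phi)^{\rm N}+p^{\rm N})-b^-v^{\rm S}(E^{\rm S}+(\rho\phi)^{\rm S}+p^{\rm S})}{b^+-b^-}+\beta\Big[E^{\rm S}-E^{\rm N}+H(\psi)\big((\rho\phi)^{\rm S}-(\rho\phi)^{\rm N}-\delta(E+\rho\phi)\big)\Big].$$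 **Standing assumption.** The data are such that all quantities are well defined: densities $\overline\rho_{j,k}$, $\rho^{\rm X}_{j,k}$ and pressures $p^{\rm X}_{j,k}$ are positive wherever used, and the denominators in $\psi$ are nonzero. *)

theory Defs
  imports "HOL-Analysis.Analysis"
begin

(* Conventions.  Cells are indexed by pairs (j,k) of integers.  A quantity living on the vertical
   interface (j+1/2,k), respectively on the horizontal interface (j,k+1/2), is stored at index
   (j,k); thus the value at (j-1/2,k) is stored at (j-1,k). *)

(* The mesh is x_j = x_orig + j * dx, y_k = y_orig + k * dy. *)
record cu_scheme =
  jl :: int
  jr :: int
  kl :: int
  kr :: int
  x_orig :: real
  y_orig :: real
  dx :: real
  dy :: real
  pot :: "real \<Rightarrow> real \<Rightarrow> real"
  gam :: real
  theta :: real
  cut_C :: real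
  cut_m :: nat

(* The discrete data at one instant: cell averages of (rho, rho u, rho v, E + rho phi) in the
   interior cells, and the prescribed values in the ghost cells. *)
record cu_data =
  avg :: "int \<Rightarrow> int \<Rightarrow> real ^ 4"
  rho_gh :: "int \<Rightarrow> int \<Rightarrow> real"
  u_gh :: "int \<Rightarrow> int \<Rightarrow> real"
  v_gh :: "int \<Rightarrow> int \<Rightarrow> real"
  K_gh :: "int \<Rightarrow> int \<Rightarrow> real"
  L_gh :: "int \<Rightarrow> int \<Rightarrow> real"

definition x_ctr :: "cu_scheme \<Rightarrow> int \<Rightarrow> real" where
  "x_ctr s j = x_orig s + real_of_int j * dx s"

definition y_ctr :: "cu_scheme \<Rightarrow> int \<Rightarrow> real" where
  "y_ctr s k = y_orig s + real_of_int k * dy s"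

definition x_ifc :: "cu_scheme \<Rightarrow> int \<Rightarrow> real" where
  "x_ifc s j = x_orig s + (real_of_int j + 1 / 2) * dx s"

definition y_ifc :: "cu_scheme \<Rightarrow> int \<Rightarrow> real" where
  "y_ifc s k = y_orig s + (real_of_int k + 1 / 2) * dy s"

definition interior_cells :: "cu_scheme \<Rightarrow> (int \<times> int) set" where
  "interior_cells s = {jl s..jr s} \<times> {kl s..kr s}"

(* The cells of a row (column) of the grid with its two ghost cells at either end.  Corner ghost
   cells belong to neither set; the scheme never uses them. *)
definition x_cells :: "cu_scheme \<Rightarrow> (int \<times> int) set" where
  "x_cells s = {jl s - 2..jr s + 2} \<times> {kl s..kr s}"

definition y_cells :: "cu_scheme \<Rightarrow> (int \<times> int) set" where
  "y_cells s = {jl s..jr s} \<times> {kl s - 2..kr s + 2}"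

(* The interfaces at which the fluxes are computed. *)
definition x_ifcs :: "cu_scheme \<Rightarrow> (int \<times> int) set" where
  "x_ifcs s = {jl s - 1..jr s} \<times> {kl s..kr s}"

definition y_ifcs :: "cu_scheme \<Rightarrow> (int \<times> int) set" where
  "y_ifcs s = {jl s..jr s} \<times> {kl s - 1..kr s}"

(* Differentiability of the potential is only required inside the computational domain, where the
   scheme evaluates phi_x and phi_y. *)
definition valid_scheme :: "cu_scheme \<Rightarrow> bool" where
  "valid_scheme s \<longleftrightarrow>
     jl s \<le> jr s \<and> kl s \<le> kr s \<and> dx s > 0 \<and> dy s > 0 \<and> gam s > 1 \<and>
     1 \<le> theta s \<and> theta s \<le> 2 \<and> cut_C s > 0 \<and> cut_m s > 0 \<and>
     continuous_on ({x_ifc s (jl s - 1)..x_ifc s (jr s)} \<times> {y_ifc s (kl s - 1)..y_ifc s (kr s)})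
       (\<lambda>(x, y). pot s x y) \<and>
     (\<forall>x\<in>{x_ifc s (jl s - 1)<..<x_ifc s (jr s)}. \<forall>y\<in>{y_ifc s (kl s - 1)<..<y_ifc s (kr s)}.
       (\<lambda>\<xi>. pot s \<xi> y) differentiable (at x) \<and> (\<lambda>\<eta>. pot s x \<eta>) differentiable (at y))"

definition pot_x :: "cu_scheme \<Rightarrow> real \<Rightarrow> real \<Rightarrow> real" where
  "pot_x s x y = deriv (\<lambda>\<xi>. pot s \<xi> y) x"

definition pot_y :: "cu_scheme \<Rightarrow> real \<Rightarrow> real \<Rightarrow> real" where
  "pot_y s x y = deriv (\<lambda>\<eta>. pot s x \<eta>) y"

definition rho_bar :: "cu_scheme \<Rightarrow> cu_data \<Rightarrow> int \<Rightarrow> int \<Rightarrow> real" where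
  "rho_bar s d j k = (if (j, k) \<in> interior_cells s then avg d j k $ 1 else rho_gh d j k)"

definition rhou_bar :: "cu_scheme \<Rightarrow> cu_data \<Rightarrow> int \<Rightarrow> int \<Rightarrow> real" where
  "rhou_bar s d j k =
     (if (j, k) \<in> interior_cells s then avg d j k $ 2 else rho_gh d j k * u_gh d j k)"

definition rhov_bar :: "cu_scheme \<Rightarrow> cu_data \<Rightarrow> int \<Rightarrow> int \<Rightarrow> real" where
  "rhov_bar s d j k =
     (if (j, k) \<in> interior_cells s then avg d j k $ 3 else rho_gh d j k * v_gh d j k)"

definition u_cell :: "cu_scheme \<Rightarrow> cu_data \<Rightarrow> int \<Rightarrow> int \<Rightarrow> real" where
  "u_cell s d j k =
     (if (j, k) \<in> interior_cells s then rhou_bar s d j k / rho_bar s d j k else u_gh d j k)"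

definition v_cell :: "cu_scheme \<Rightarrow> cu_data \<Rightarrow> int \<Rightarrow> int \<Rightarrow> real" where
  "v_cell s d j k =
     (if (j, k) \<in> interior_cells s then rhov_bar s d j k / rho_bar s d j k else v_gh d j k)"

(* Total energy and pressure are only meaningful in interior cells. *)
definition E_bar :: "cu_scheme \<Rightarrow> cu_data \<Rightarrow> int \<Rightarrow> int \<Rightarrow> real" where
  "E_bar s d j k = avg d j k $ 4 - rho_bar s d j k * pot s (x_ctr s j) (y_ctr s k)"

definition p_cell :: "cu_scheme \<Rightarrow> cu_data \<Rightarrow> int \<Rightarrow> int \<Rightarrow> real" where
  "p_cell s d j k =
     (gam s - 1) *
     (E_bar s d j k - 1 / 2 * rho_bar s d j k * ((u_cell s d j k)\<^sup>2 + (v_cell s d j k)\<^sup>2))"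

(* Q at (j+1/2,k).  The recursion starts from Q = 0 at index jl - 1, i.e. at the left end of the
   grid; only indices jl - 1, ..., jr are meaningful. *)
function Q_ifc :: "cu_scheme \<Rightarrow> cu_data \<Rightarrow> int \<Rightarrow> int \<Rightarrow> real" where
  "Q_ifc s d j k =
     (if j < jl s then 0
      else Q_ifc s d (j - 1) k + dx s * rho_bar s d j k * pot_x s (x_ctr s j) (y_ctr s k))"
  by pat_completeness auto
termination by (relation "Wellfounded.measure (\<lambda>(s, d, j, k). nat (j - jl s + 1))") auto

function R_ifc :: "cu_scheme \<Rightarrow> cu_data \<Rightarrow> int \<Rightarrow> int \<Rightarrow> real" where
  "R_ifc s d j k =
     (if k < kl s then 0
      else R_ifc s d j (k - 1) + dy s * rho_bar s d j k * pot_y s (x_ctr s j) (y_ctr s k))"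
  by pat_completeness auto
termination by (relation "Wellfounded.measure (\<lambda>(s, d, j, k). nat (k - kl s + 1))") auto

declare Q_ifc.simps [simp del] R_ifc.simps [simp del]

definition Q_cell :: "cu_scheme \<Rightarrow> cu_data \<Rightarrow> int \<Rightarrow> int \<Rightarrow> real" where
  "Q_cell s d j k = (Q_ifc s d (j - 1) k + Q_ifc s d j k) / 2"

definition R_cell :: "cu_scheme \<Rightarrow> cu_data \<Rightarrow> int \<Rightarrow> int \<Rightarrow> real" where
  "R_cell s d j k = (R_ifc s d j (k - 1) + R_ifc s d j k) / 2"

definition K_cell :: "cu_scheme \<Rightarrow> cu_data \<Rightarrow> int \<Rightarrow> int \<Rightarrow> real" where
  "K_cell s d j k =
     (if (j, k) \<in> interior_cells s then p_cell s d j k + Q_cell s d j k else K_gh d j k)"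

definition L_cell :: "cu_scheme \<Rightarrow> cu_data \<Rightarrow> int \<Rightarrow> int \<Rightarrow> real" where
  "L_cell s d j k =
     (if (j, k) \<in> interior_cells s then p_cell s d j k + R_cell s d j k else L_gh d j k)"

definition minmod :: "real set \<Rightarrow> real" where
  "minmod Z =
     (if \<forall>z\<in>Z. z > 0 then Min Z else if \<forall>z\<in>Z. z < 0 then Max Z else 0)"

definition slope_x :: "cu_scheme \<Rightarrow> (int \<Rightarrow> int \<Rightarrow> real) \<Rightarrow> int \<Rightarrow> int \<Rightarrow> real" where
  "slope_x s w j k =
     minmod {theta s * ((w (j + 1) k - w j k) / dx s),
             (w (j + 1) k - w (j - 1) k) / (2 * dx s),
             theta s * ((w j k - w (j - 1) k) / dx s)}"

definition slope_y :: "cu_scheme \<Rightarrow> (int \<Rightarrow> int \<Rightarrow> real) \<Rightarrow> int \<Rightarrow> int \<Rightarrow> real" where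
  "slope_y s w j k =
     minmod {theta s * ((w j (k + 1) - w j k) / dy s),
             (w j (k + 1) - w j (k - 1)) / (2 * dy s),
             theta s * ((w j k - w j (k - 1)) / dy s)}"

datatype side = East | West | North | South

fun recon :: "cu_scheme \<Rightarrow> side \<Rightarrow> (int \<Rightarrow> int \<Rightarrow> real) \<Rightarrow> int \<Rightarrow> int \<Rightarrow> real" where
  "recon s East w j k = w j k + dx s / 2 * slope_x s w j k"
| "recon s West w j k = w j k - dx s / 2 * slope_x s w j k"
| "recon s North w j k = w j k + dy s / 2 * slope_y s w j k"
| "recon s South w j k = w j k - dy s / 2 * slope_y s w j k"

definition rho_pt :: "cu_scheme \<Rightarrow> cu_data \<Rightarrow> side \<Rightarrow> int \<Rightarrow> int \<Rightarrow> real" where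
  "rho_pt s d X j k = recon s X (rho_bar s d) j k"

definition rhou_pt :: "cu_scheme \<Rightarrow> cu_data \<Rightarrow> side \<Rightarrow> int \<Rightarrow> int \<Rightarrow> real" where
  "rhou_pt s d X j k = recon s X (rhou_bar s d) j k"

definition rhov_pt :: "cu_scheme \<Rightarrow> cu_data \<Rightarrow> side \<Rightarrow> int \<Rightarrow> int \<Rightarrow> real" where
  "rhov_pt s d X j k = recon s X (rhov_bar s d) j k"

(* Used with East and West only. *)
definition K_pt :: "cu_scheme \<Rightarrow> cu_data \<Rightarrow> side \<Rightarrow> int \<Rightarrow> int \<Rightarrow> real" where
  "K_pt s d X j k = recon s X (K_cell s d) j k"

(* Used with North and South only. *)
definition L_pt :: "cu_scheme \<Rightarrow> cu_data \<Rightarrow> side \<Rightarrow> int \<Rightarrow> int \<Rightarrow> real" where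
  "L_pt s d X j k = recon s X (L_cell s d) j k"

definition u_pt :: "cu_scheme \<Rightarrow> cu_data \<Rightarrow> side \<Rightarrow> int \<Rightarrow> int \<Rightarrow> real" where
  "u_pt s d X j k = rhou_pt s d X j k / rho_pt s d X j k"

definition v_pt :: "cu_scheme \<Rightarrow> cu_data \<Rightarrow> side \<Rightarrow> int \<Rightarrow> int \<Rightarrow> real" where
  "v_pt s d X j k = rhov_pt s d X j k / rho_pt s d X j k"

fun p_pt :: "cu_scheme \<Rightarrow> cu_data \<Rightarrow> side \<Rightarrow> int \<Rightarrow> int \<Rightarrow> real" where
  "p_pt s d East j k = K_pt s d East j k - Q_ifc s d j k"
| "p_pt s d West j k = K_pt s d West j k - Q_ifc s d (j - 1) k"
| "p_pt s d North j k = L_pt s d North j k - R_ifc s d j k"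
| "p_pt s d South j k = L_pt s d South j k - R_ifc s d j (k - 1)"

definition E_pt :: "cu_scheme \<Rightarrow> cu_data \<Rightarrow> side \<Rightarrow> int \<Rightarrow> int \<Rightarrow> real" where
  "E_pt s d X j k =
     p_pt s d X j k / (gam s - 1) +
     1 / 2 * rho_pt s d X j k * ((u_pt s d X j k)\<^sup>2 + (v_pt s d X j k)\<^sup>2)"

definition c_pt :: "cu_scheme \<Rightarrow> cu_data \<Rightarrow> side \<Rightarrow> int \<Rightarrow> int \<Rightarrow> real" where
  "c_pt s d X j k = sqrt (gam s * p_pt s d X j k / rho_pt s d X j k)"

fun rhopot_pt :: "cu_scheme \<Rightarrow> cu_data \<Rightarrow> side \<Rightarrow> int \<Rightarrow> int \<Rightarrow> real" where
  "rhopot_pt s d East j k = rho_pt s d East j k * pot s (x_ifc s j) (y_ctr s k)"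
| "rhopot_pt s d West j k = rho_pt s d West j k * pot s (x_ifc s (j - 1)) (y_ctr s k)"
| "rhopot_pt s d North j k = rho_pt s d North j k * pot s (x_ctr s j) (y_ifc s k)"
| "rhopot_pt s d South j k = rho_pt s d South j k * pot s (x_ctr s j) (y_ifc s (k - 1))"

definition vec4 :: "real \<Rightarrow> real \<Rightarrow> real \<Rightarrow> real \<Rightarrow> real ^ 4" where
  "vec4 a b c e = (\<chi> i. if i = 1 then a else if i = 2 then b else if i = 3 then c else e)"

definition q_pt :: "cu_scheme \<Rightarrow> cu_data \<Rightarrow> side \<Rightarrow> int \<Rightarrow> int \<Rightarrow> real ^ 4" where
  "q_pt s d X j k =
     vec4 (rho_pt s d X j k) (rhou_pt s d X j k) (rhov_pt s d X j k)
       (E_pt s d X j k + rhopot_pt s d X j k)"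

(* The continuous fluxes F (for East and West) and G (for North and South) at one-sided values. *)
definition F_pt :: "cu_scheme \<Rightarrow> cu_data \<Rightarrow> side \<Rightarrow> int \<Rightarrow> int \<Rightarrow> real ^ 4" where
  "F_pt s d X j k =
     vec4 (rhou_pt s d X j k)
       (rho_pt s d X j k * (u_pt s d X j k)\<^sup>2 + K_pt s d X j k)
       (rho_pt s d X j k * u_pt s d X j k * v_pt s d X j k)
       (u_pt s d X j k * (E_pt s d X j k + rhopot_pt s d X j k + p_pt s d X j k))"

definition G_pt :: "cu_scheme \<Rightarrow> cu_data \<Rightarrow> side \<Rightarrow> int \<Rightarrow> int \<Rightarrow> real ^ 4" where
  "G_pt s d X j k =
     vec4 (rhov_pt s d X j k)
       (rho_pt s d X j k * u_pt s d X j k * v_pt s d X j k)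
       (rho_pt s d X j k * (v_pt s d X j k)\<^sup>2 + L_pt s d X j k)
       (v_pt s d X j k * (E_pt s d X j k + rhopot_pt s d X j k + p_pt s d X j k))"

definition a_plus :: "cu_scheme \<Rightarrow> cu_data \<Rightarrow> int \<Rightarrow> int \<Rightarrow> real" where
  "a_plus s d j k =
     Max {u_pt s d East j k + c_pt s d East j k,
          u_pt s d West (j + 1) k + c_pt s d West (j + 1) k, 0}"

definition a_minus :: "cu_scheme \<Rightarrow> cu_data \<Rightarrow> int \<Rightarrow> int \<Rightarrow> real" where
  "a_minus s d j k =
     Min {u_pt s d East j k - c_pt s d East j k,
          u_pt s d West (j + 1) k - c_pt s d West (j + 1) k, 0}"

definition b_plus :: "cu_scheme \<Rightarrow> cu_data \<Rightarrow> int \<Rightarrow> int \<Rightarrow> real" where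
  "b_plus s d j k =
     Max {v_pt s d North j k + c_pt s d North j k,
          v_pt s d South j (k + 1) + c_pt s d South j (k + 1), 0}"

definition b_minus :: "cu_scheme \<Rightarrow> cu_data \<Rightarrow> int \<Rightarrow> int \<Rightarrow> real" where
  "b_minus s d j k =
     Min {v_pt s d North j k - c_pt s d North j k,
          v_pt s d South j (k + 1) - c_pt s d South j (k + 1), 0}"

definition q_star_x :: "cu_scheme \<Rightarrow> cu_data \<Rightarrow> int \<Rightarrow> int \<Rightarrow> real ^ 4" where
  "q_star_x s d j k =
     (let ap = a_plus s d j k; am = a_minus s d j k in
      (1 / (ap - am)) *\<^sub>R
        (ap *\<^sub>R q_pt s d West (j + 1) k - am *\<^sub>R q_pt s d East j k
         - (F_pt s d West (j + 1) k - F_pt s d East j k)))"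

definition q_star_y :: "cu_scheme \<Rightarrow> cu_data \<Rightarrow> int \<Rightarrow> int \<Rightarrow> real ^ 4" where
  "q_star_y s d j k =
     (let bp = b_plus s d j k; bm = b_minus s d j k in
      (1 / (bp - bm)) *\<^sub>R
        (bp *\<^sub>R q_pt s d South j (k + 1) - bm *\<^sub>R q_pt s d North j k
         - (G_pt s d South j (k + 1) - G_pt s d North j k)))"

definition dq_x :: "cu_scheme \<Rightarrow> cu_data \<Rightarrow> int \<Rightarrow> int \<Rightarrow> real ^ 4" where
  "dq_x s d j k =
     (\<chi> i. minmod {(q_pt s d West (j + 1) k - q_star_x s d j k) $ i,
                   (q_star_x s d j k - q_pt s d East j k) $ i})"

definition dq_y :: "cu_scheme \<Rightarrow> cu_data \<Rightarrow> int \<Rightarrow> int \<Rightarrow> real ^ 4" where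
  "dq_y s d j k =
     (\<chi> i. minmod {(q_pt s d South j (k + 1) - q_star_y s d j k) $ i,
                   (q_star_y s d j k - q_pt s d North j k) $ i})"

definition cutoff :: "cu_scheme \<Rightarrow> real \<Rightarrow> real" where
  "cutoff s z = (cut_C s * z) ^ cut_m s / (1 + (cut_C s * z) ^ cut_m s)"

definition K_max :: "cu_scheme \<Rightarrow> cu_data \<Rightarrow> real" where
  "K_max s d = Max (\<Union>(j, k)\<in>x_ifcs s. {K_cell s d j k, K_cell s d (j + 1) k})"

definition L_max :: "cu_scheme \<Rightarrow> cu_data \<Rightarrow> real" where
  "L_max s d = Max (\<Union>(j, k)\<in>y_ifcs s. {L_cell s d j k, L_cell s d j (k + 1)})"

definition psi_x :: "cu_scheme \<Rightarrow> cu_data \<Rightarrow> int \<Rightarrow> int \<Rightarrow> real" where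
  "psi_x s d j k =
     \<bar>K_cell s d (j + 1) k - K_cell s d j k\<bar> / dx s
     * ((x_ifc s (jr s) - x_ifc s (jl s - 1)) / K_max s d)"

definition psi_y :: "cu_scheme \<Rightarrow> cu_data \<Rightarrow> int \<Rightarrow> int \<Rightarrow> real" where
  "psi_y s d j k =
     \<bar>L_cell s d j (k + 1) - L_cell s d j k\<bar> / dy s
     * ((y_ifc s (kr s) - y_ifc s (kl s - 1)) / L_max s d)"

definition flux_x :: "cu_scheme \<Rightarrow> cu_data \<Rightarrow> int \<Rightarrow> int \<Rightarrow> real ^ 4" where
  "flux_x s d j k =
     (let ap = a_plus s d j k; am = a_minus s d j k; \<alpha> = ap * am / (ap - am);
          h = cutoff s (psi_x s d j k); dq = dq_x s d j k;
          rhoE = rho_pt s d East j k; rhoW = rho_pt s d West (j + 1) k;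
          rhouE = rhou_pt s d East j k; rhouW = rhou_pt s d West (j + 1) k;
          rhovE = rhov_pt s d East j k; rhovW = rhov_pt s d West (j + 1) k;
          uE = u_pt s d East j k; uW = u_pt s d West (j + 1) k;
          vE = v_pt s d East j k; vW = v_pt s d West (j + 1) k;
          KE = K_pt s d East j k; KW = K_pt s d West (j + 1) k;
          pE = p_pt s d East j k; pW = p_pt s d West (j + 1) k;
          enE = E_pt s d East j k; enW = E_pt s d West (j + 1) k;
          rpE = rhopot_pt s d East j k; rpW = rhopot_pt s d West (j + 1) k
      in vec4
        ((ap * rhouE - am * rhouW) / (ap - am) + \<alpha> * h * (rhoW - rhoE - dq $ 1))
        ((ap * (rhoE * uE\<^sup>2 + KE) - am * (rhoW * uW\<^sup>2 + KW)) / (ap - am)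
          + \<alpha> * (rhouW - rhouE - dq $ 2))
        ((ap * (rhoE * uE * vE) - am * (rhoW * uW * vW)) / (ap - am)
          + \<alpha> * (rhovW - rhovE - dq $ 3))
        ((ap * (uE * (enE + rpE + pE)) - am * (uW * (enW + rpW + pW))) / (ap - am)
          + \<alpha> * (enW - enE + h * (rpW - rpE - dq $ 4))))"

definition flux_y :: "cu_scheme \<Rightarrow> cu_data \<Rightarrow> int \<Rightarrow> int \<Rightarrow> real ^ 4" where
  "flux_y s d j k =
     (let bp = b_plus s d j k; bm = b_minus s d j k; \<beta> = bp * bm / (bp - bm);
          h = cutoff s (psi_y s d j k); dq = dq_y s d j k;
          rhoN = rho_pt s d North j k; rhoS = rho_pt s d South j (k + 1);
          rhouN = rhou_pt s d North j k; rhouS = rhou_pt s d South j (k + 1);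
          rhovN = rhov_pt s d North j k; rhovS = rhov_pt s d South j (k + 1);
          uN = u_pt s d North j k; uS = u_pt s d South j (k + 1);
          vN = v_pt s d North j k; vS = v_pt s d South j (k + 1);
          LN = L_pt s d North j k; LS = L_pt s d South j (k + 1);
          pN = p_pt s d North j k; pS = p_pt s d South j (k + 1);
          enN = E_pt s d North j k; enS = E_pt s d South j (k + 1);
          rpN = rhopot_pt s d North j k; rpS = rhopot_pt s d South j (k + 1)
      in vec4
        ((bp * rhovN - bm * rhovS) / (bp - bm) + \<beta> * h * (rhoS - rhoN - dq $ 1))
        ((bp * (rhoN * uN * vN) - bm * (rhoS * uS * vS)) / (bp - bm)
          + \<beta> * (rhouS - rhouN - dq $ 2))
        ((bp * (rhoN * vN\<^sup>2 + LN) - bm * (rhoS * vS\<^sup>2 + LS)) / (bp - bm)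
          + \<beta> * (rhovS - rhovN - dq $ 3))
        ((bp * (vN * (enN + rpN + pN)) - bm * (vS * (enS + rpS + pS))) / (bp - bm)
          + \<beta> * (enS - enN + h * (rpS - rpN - dq $ 4))))"

(* The right-hand side of the ODE system d/dt avg j k = scheme_rhs j k. *)
definition scheme_rhs :: "cu_scheme \<Rightarrow> cu_data \<Rightarrow> int \<Rightarrow> int \<Rightarrow> real ^ 4" where
  "scheme_rhs s d j k =
     - ((1 / dx s) *\<^sub>R (flux_x s d j k - flux_x s d (j - 1) k))
     - (1 / dy s) *\<^sub>R (flux_y s d j k - flux_y s d j (k - 1))"

(* The standing assumption that all quantities entering the fluxes are well defined. *)
definition well_defined :: "cu_scheme \<Rightarrow> cu_data \<Rightarrow> bool" where
  "well_defined s d \<longleftrightarrow>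
     (\<forall>(j, k)\<in>x_cells s \<union> y_cells s. rho_bar s d j k > 0) \<and>
     (\<forall>(j, k)\<in>x_ifcs s.
        rho_pt s d East j k > 0 \<and> rho_pt s d West (j + 1) k > 0 \<and>
        p_pt s d East j k > 0 \<and> p_pt s d West (j + 1) k > 0) \<and>
     (\<forall>(j, k)\<in>y_ifcs s.
        rho_pt s d North j k > 0 \<and> rho_pt s d South j (k + 1) > 0 \<and>
        p_pt s d North j k > 0 \<and> p_pt s d South j (k + 1) > 0) \<and>
     K_max s d \<noteq> 0 \<and> L_max s d \<noteq> 0"

end

(* At the steady state the reconstruction reproduces the vanishing momenta and the constant K
   (respectively L), and the two pressures at an interface subtract the same Q (respectively R).
   The one-sided pressures, hence energies, therefore agree, while the cut-off H(0) = 0 switches off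
   the diffusion acting on the possibly discontinuous density.  The fluxes reduce to the momentum
   fluxes K and L, which are constant in x and in y respectively. *)
theory Submission
  imports Defs
begin

lemma minmod_eq_0: "0 \<in> Z \<Longrightarrow> minmod Z = 0"
  by (force simp: minmod_def)

lemma cutoff_0: "cut_m s > 0 \<Longrightarrow> cutoff s 0 = 0"
  by (simp add: cutoff_def)

lemma vec4_nth [simp]:
  "vec4 a b c e $ 1 = a" "vec4 a b c e $ 2 = b" "vec4 a b c e $ 3 = c" "vec4 a b c e $ 4 = e"
  by (simp_all add: vec4_def)

text \<open>Equal neighbours make every difference in the slope 0, and an argument 0 forces the
  minmod to 0.\<close>

lemma recon_x_const:
  assumes "X \<in> {East, West}" and "w (j - 1) k = c" "w j k = c" "w (j + 1) k = c"
  shows "recon s X w j k = c"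
  using assms by (auto simp: slope_x_def minmod_eq_0)

lemma recon_y_const:
  assumes "X \<in> {North, South}" and "w j (k - 1) = c" "w j k = c" "w j (k + 1) = c"
  shows "recon s X w j k = c"
  using assms by (auto simp: slope_y_def minmod_eq_0)

text \<open>In an interior cell the velocity is a quotient, and division by 0 yields 0, so
  positivity of the density is what carries zero velocity over to the momentum.\<close>

lemma rhou_bar_eq_0: "u_cell s d j k = 0 \<Longrightarrow> rho_bar s d j k > 0 \<Longrightarrow> rhou_bar s d j k = 0"
  by (auto simp: u_cell_def rhou_bar_def split: if_splits)

lemma rhov_bar_eq_0: "v_cell s d j k = 0 \<Longrightarrow> rho_bar s d j k > 0 \<Longrightarrow> rhov_bar s d j k = 0"
  by (auto simp: v_cell_def rhov_bar_def split: if_splits)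

lemma c_pt_pos:
  "gam s > 0 \<Longrightarrow> p_pt s d X j k > 0 \<Longrightarrow> rho_pt s d X j k > 0 \<Longrightarrow> c_pt s d X j k > 0"
  by (simp add: c_pt_def)

text \<open>The flux uses the reconstructions in cells \<open>j\<close> and \<open>j + 1\<close>,
  each with a three-cell stencil; hence the range from \<open>j - 1\<close> to
  \<open>j + 2\<close>.\<close>

lemma flux_x_steady:
  assumes valid: "valid_scheme s" and wd: "well_defined s d"
    and still: "\<forall>i\<in>{j - 1..j + 2}. u_cell s d i k = 0 \<and> v_cell s d i k = 0"
    and K: "\<forall>i\<in>{j - 1..j + 2}. K_cell s d i k = c"
    and ifc: "(j, k) \<in> x_ifcs s"
  shows "flux_x s d j k = vec4 0 c 0 0"
proof -
  have "rho_bar s d i k > 0" if "i \<in> {j - 1..j + 2}" for i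
    using wd ifc that by (auto simp: well_defined_def x_ifcs_def x_cells_def)
  then have mom: "rhou_bar s d i k = 0" "rhov_bar s d i k = 0" if "i \<in> {j - 1..j + 2}" for i
    using still that by (auto intro: rhou_bar_eq_0 rhov_bar_eq_0)
  have mom_pt: "rhou_pt s d East j k = 0" "rhov_pt s d East j k = 0" "K_pt s d East j k = c"
      "rhou_pt s d West (j + 1) k = 0" "rhov_pt s d West (j + 1) k = 0" "K_pt s d West (j + 1) k = c"
    unfolding rhou_pt_def rhov_pt_def K_pt_def
    by (rule recon_x_const; simp add: mom K)+
  then have vel: "u_pt s d East j k = 0" "v_pt s d East j k = 0"
      "u_pt s d West (j + 1) k = 0" "v_pt s d West (j + 1) k = 0"
    by (simp_all add: u_pt_def v_pt_def)
  \<comment> \<open>The West pressure of cell \<open>j + 1\<close> subtracts \<open>Q\<close> at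
    index \<open>(j + 1) - 1 = j\<close>, as the East pressure of cell \<open>j\<close>
    does.\<close>
  have E: "E_pt s d East j k = E_pt s d West (j + 1) k"
    by (simp add: E_pt_def vel mom_pt)
  \<comment> \<open>With zero velocities this makes \<open>a_plus\<close> positive and
    \<open>a_minus\<close> negative, so the denominator of the flux is nonzero.\<close>
  have "c_pt s d East j k > 0"
    using valid wd ifc by (auto intro!: c_pt_pos simp: valid_scheme_def well_defined_def simp del: p_pt.simps)
  then have "a_plus s d j k - a_minus s d j k > 0"
    by (simp add: a_plus_def a_minus_def vel max_def min_def)
  \<comment> \<open>Only the momentum components of the anti-diffusion have to vanish here: the
    density and energy components are multiplied by the cut-off.\<close>
  moreover have "q_star_x s d j k $ 2 = 0" "q_star_x s d j k $ 3 = 0"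
    by (simp_all add: q_star_x_def Let_def q_pt_def F_pt_def mom_pt vel)
  then have "dq_x s d j k $ 2 = 0" "dq_x s d j k $ 3 = 0"
    by (simp_all add: dq_x_def q_pt_def mom_pt minmod_eq_0)
  moreover have "psi_x s d j k = 0"
    using K by (simp add: psi_x_def)
  then have "cutoff s (psi_x s d j k) = 0"
    using valid by (simp add: cutoff_0 valid_scheme_def)
  \<comment> \<open>Factoring \<open>c\<close> out of \<open>a_plus * c - a_minus * c\<close> lets
    the positive denominator cancel.\<close>
  ultimately show ?thesis
    by (simp add: flux_x_def Let_def mom_pt vel E flip: left_diff_distrib)
qed

text \<open>The same argument with the two directions exchanged; the constant now sits in the
  y-momentum component.\<close>

lemma flux_y_steady:
  assumes valid: "valid_scheme s" and wd: "well_defined s d"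
    and still: "\<forall>i\<in>{k - 1..k + 2}. u_cell s d j i = 0 \<and> v_cell s d j i = 0"
    and L: "\<forall>i\<in>{k - 1..k + 2}. L_cell s d j i = c"
    and ifc: "(j, k) \<in> y_ifcs s"
  shows "flux_y s d j k = vec4 0 0 c 0"
proof -
  have "rho_bar s d j i > 0" if "i \<in> {k - 1..k + 2}" for i
    using wd ifc that by (auto simp: well_defined_def y_ifcs_def y_cells_def)
  then have mom: "rhou_bar s d j i = 0" "rhov_bar s d j i = 0" if "i \<in> {k - 1..k + 2}" for i
    using still that by (auto intro: rhou_bar_eq_0 rhov_bar_eq_0)
  have mom_pt: "rhou_pt s d North j k = 0" "rhov_pt s d North j k = 0" "L_pt s d North j k = c"
      "rhou_pt s d South j (k + 1) = 0" "rhov_pt s d South j (k + 1) = 0" "L_pt s d South j (k + 1) = c"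
    unfolding rhou_pt_def rhov_pt_def L_pt_def
    by (rule recon_y_const; simp add: mom L)+
  then have vel: "u_pt s d North j k = 0" "v_pt s d North j k = 0"
      "u_pt s d South j (k + 1) = 0" "v_pt s d South j (k + 1) = 0"
    by (simp_all add: u_pt_def v_pt_def)
  have E: "E_pt s d North j k = E_pt s d South j (k + 1)"
    by (simp add: E_pt_def vel mom_pt)
  have "c_pt s d North j k > 0"
    using valid wd ifc by (auto intro!: c_pt_pos simp: valid_scheme_def well_defined_def simp del: p_pt.simps)
  then have "b_plus s d j k - b_minus s d j k > 0"
    by (simp add: b_plus_def b_minus_def vel max_def min_def)
  moreover have "q_star_y s d j k $ 2 = 0" "q_star_y s d j k $ 3 = 0"
    by (simp_all add: q_star_y_def Let_def q_pt_def G_pt_def mom_pt vel)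
  then have "dq_y s d j k $ 2 = 0" "dq_y s d j k $ 3 = 0"
    by (simp_all add: dq_y_def q_pt_def mom_pt minmod_eq_0)
  moreover have "psi_y s d j k = 0"
    using L by (simp add: psi_y_def)
  then have "cutoff s (psi_y s d j k) = 0"
    using valid by (simp add: cutoff_0 valid_scheme_def)
  ultimately show ?thesis
    by (simp add: flux_y_def Let_def mom_pt vel E flip: left_diff_distrib)
qed

theorem theorem3p1:
  fixes s :: cu_scheme and d :: cu_data
    and Khat Lhat :: "int \<Rightarrow> real"
  assumes "valid_scheme s"
    and "well_defined s d"
    and "\<forall>(j, k)\<in>x_cells s \<union> y_cells s. u_cell s d j k = 0 \<and> v_cell s d j k = 0"
    and "\<forall>(j, k)\<in>x_cells s. K_cell s d j k = Khat k"
    and "\<forall>(j, k)\<in>y_cells s. L_cell s d j k = Lhat j"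
  shows "\<forall>j\<in>{jl s..jr s}. \<forall>k\<in>{kl s..kr s}. scheme_rhs s d j k = 0"
proof (intro ballI)
  fix j k assume jk: "j \<in> {jl s..jr s}" "k \<in> {kl s..kr s}"
  \<comment> \<open>Taking \<open>i = j\<close> and \<open>i = j - 1\<close> gives equal fluxes on
    both sides of the cell. At the outermost interfaces the stencil just reaches the second ghost
    layer.\<close>
  have "flux_x s d i k = vec4 0 (Khat k) 0 0" if "(i, k) \<in> x_ifcs s" for i
    using assms that by (intro flux_x_steady) (auto simp: x_ifcs_def x_cells_def)
  moreover have "flux_y s d j i = vec4 0 0 (Lhat j) 0" if "(j, i) \<in> y_ifcs s" for i
    using assms that by (intro flux_y_steady) (auto simp: y_ifcs_def y_cells_def)
  ultimately show "scheme_rhs s d j k = 0"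
    using jk by (simp add: scheme_rhs_def x_ifcs_def y_ifcs_def)
qed

end
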